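(* Let $m,p,N\in\mathbb{N}$ with $p\ge m+1$ and $N>p$, let $h=1/N$, and let $\mathbf{V}_h^p$ be the space of closed B-spline curves of degree $p$ on $[0,1]$. Let $F\colon(\mathbb{R}^2)^{m+1}\to\mathbb{R}$, let $G(\mathbf{p}_0,\dots,\mathbf{p}_m)=F(\mathbf{p}_0,\dots,\mathbf{p}_m)\,|\mathbf{p}_1|$, let $$E[\mathbf{u}]=\int_0^1 G(\mathbf{u},\mathbf{u}_\zeta,\dots,\partial_\zeta^m\mathbf{u})\,d\zeta ,\qquad \mathbf{u}\in\mathbf{H}^m_\pi,$$ and let $\dfrac{\partial G_{\mathrm{d}}}{\partial(\partial_\zeta^j\mathbf{u},\partial_\zeta^j\mathbf{v})}$, $j=0,\dots,m$, be discrete partial derivatives of $G$. Let $\Delta t_n>0$ and let $\mathbf{u}_h^n,\mathbf{u}_h^{n+1}\in\mathbf{V}_h^p$ satisfy $$\left(\left|\frac{\mathbf{u}^{n+1}_{h,\zeta}+\mathbf{u}^n_{h,\zeta}}{2}\right|\frac{\mathbf{u}_h^{n+1}-\mathbf{u}_h^n}{\Delta t_n},\ \mathbf{v}_h\right)=-\sum_{j=0}^m\left(\frac{\partial G_{\mathrm{d}}}{\partial(\partial_\zeta^j\mathbf{u}_h^{n+1},\partial_\zeta^j\mathbf{u}_h^n)},\ \partial_\zeta^j\mathbf{v}_h\right)\qquad\text{for all }\mathbf{v}_h\in\mathbf{V}_h^p .$$ Then $$\frac{E[\mathbf{u}_h^{n+1}]-E[\mathbf{u}_h^n]}{\Delta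 t_n}=-\int_0^1\left|\frac{\mathbf{u}^{n+1}_{h,\zeta}+\mathbf{u}^n_{h,\zeta}}{2}\right|\left|\frac{\mathbf{u}_h^{n+1}-\mathbf{u}_h^n}{\Delta t_n}\right|^2d\zeta\le 0 .$$
   Context: Notation: $|\cdot|$ is the Euclidean norm and $\cdot$ the Euclidean inner product on $\mathbb{R}^2$; $(\mathbf{f},\mathbf{g})=\int_0^1\mathbf{f}\cdot\mathbf{g}\,d\zeta$ for $\mathbb{R}^2$-valued functions on $(0,1)$; the subscript $\zeta$ and $\partial_\zeta$ denote the derivative with respect to the curve parameter $\zeta\in[0,1]$, and $\mathbf{u}_{h,\zeta}^n=\partial_\zeta\mathbf{u}_h^n$. Function spaces. $\mathbf{H}^1_\pi=\{\mathbf{u}\in H^1(0,1;\mathbb{R}^2)\mid \mathbf{u}(0)=\mathbf{u}(1)\}$, and for $m\ge2$, $\mathbf{H}^m_\pi=\{\mathbf{u}\in H^m(0,1;\mathbb{R}^2)\mid \mathbf{u}(0)=\mathbf{u}(1),\ \mathbf{u}'\in\mathbf{H}^{m-1}_\pi\}$ (periodic Sobolev spaces, i.e. closed planar curves). Energy. $E[\mathbf{u}]$ is the integral of the energy density $F(\mathbf{u},\mathbf{u}_\zeta,\dots,\partial_\zeta^m\mathbf{u})$ along the curve $\mathbf{u}$ with respect to the line element $ds=|\mathbf{u}_\zeta|\,d\zeta$. Discrete partial derivatives. Discrete partial derivatives of $G$ are any choice, for each pair $\mathbf{u},\mathbf{v}\in\mathbf{H}^m_\pi$, of $\mathbb{R}^2$-valued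 functions $\dfrac{\partial G_{\mathrm{d}}}{\partial(\partial_\zeta^j\mathbf{u},\partial_\zeta^j\mathbf{v})}$ on $(0,1)$, $j=0,1,\dots,m$, such that for all $\mathbf{u},\mathbf{v}\in\mathbf{H}^m_\pi$ $$G(\mathbf{u},\mathbf{u}_\zeta,\dots,\partial_\zeta^m\mathbf{u})-G(\mathbf{v},\mathbf{v}_\zeta,\dots,\partial_\zeta^m\mathbf{v})=\sum_{j=0}^m\frac{\partial G_{\mathrm{d}}}{\partial(\partial_\zeta^j\mathbf{u},\partial_\zeta^j\mathbf{v})}\cdot\partial_\zeta^j(\mathbf{u}-\mathbf{v})$$ (pointwise, for a.e. $\zeta\in(0,1)$). They need not be unique; one choice is fixed. It is understood that the energies and the inner products appearing are well defined, i.e. $G(\mathbf{u},\dots,\partial_\zeta^m\mathbf{u})$ and the discrete partial derivatives that occur are integrable on $(0,1)$. Closed B-spline curves. Let $\Xi=\{\xi_i\}_{i=1}^{N+2p+1}$ with $\xi_i=(i-1-p)h$. The B-spline basis functions with respect to $\Xi$ are defined by $N_{0,i}=\chi_{[\xi_i,\xi_{i+1})}$ (characteristic function) and, for $q\ge1$, $$N_{q,i}(\xi)=\frac{\xi-\xi_i}{\xi_{i+q}-\xi_i}N_{q-1,i}(\xi)+\frac{\xi_{i+q+1}-\xi}{\xi_{i+q+1}-\xi_{i+1}}N_{q-1,i+1}(\xi).$$ The periodic B-spline basis functions $B_{p,i}\colon[0,1]\to\mathbb{R}$, $i=1,\dots,N$, are: for $i\le p$, $B_{p,i}=N_{p,i}$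 on $[0,\xi_{i+p+1}]$, $B_{p,i}=N_{p,i+N}$ on $[\xi_{i+N},1]$, and $B_{p,i}=0$ otherwise; for $p<i\le N$, $B_{p,i}=N_{p,i}|_{[0,1]}$. They are periodic $C^{p-1}$ functions on $[0,1]$. Then $$\mathbf{V}_h^p=\Big\{\textstyle\sum_{i=1}^N B_{p,i}\,\mathbf{P}_i \ \Big|\ \mathbf{P}_1,\dots,\mathbf{P}_N\in\mathbb{R}^2\Big\},$$ and $\mathbf{V}_h^p\subset\mathbf{H}^m_\pi$ since $p\ge m+1$. *)

theory Defs
  imports "HOL-Analysis.Analysis"
begin

abbreviation unit_itv :: "real measure" where
  "unit_itv \<equiv> lebesgue_on {0<..<1}"

definition inner_L2 :: "(real \<Rightarrow> real^2) \<Rightarrow> (real \<Rightarrow> real^2) \<Rightarrow> real" where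
  "inner_L2 f g = (\<integral>\<zeta>. f \<zeta> \<bullet> g \<zeta> \<partial>unit_itv)"


text \<open>
  Sobolev functions are represented by arbitrary functions on the real line. Only their values
  almost everywhere in (0,1) matter: the spaces below are invariant under modification
  on null sets and outside (0,1).
\<close>

definition L2 :: "(real \<Rightarrow> real^2) set" where
  "L2 = {f. f \<in> borel_measurable unit_itv \<and> integrable unit_itv (\<lambda>\<zeta>. (norm (f \<zeta>))\<^sup>2)}"

definition test_fun :: "(real \<Rightarrow> real) \<Rightarrow> bool" where
  "test_fun \<phi> \<longleftrightarrow> (\<forall>k x. (deriv ^^ k) \<phi> differentiable (at x)) \<and>
     (\<exists>a b. 0 < a \<and> b < 1 \<and> (\<forall>x. x \<notin> {a..b} \<longrightarrow> \<phi> x = 0))"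

definition has_weak_deriv :: "(real \<Rightarrow> real^2) \<Rightarrow> (real \<Rightarrow> real^2) \<Rightarrow> bool" where
  "has_weak_deriv u g \<longleftrightarrow>
     (\<forall>\<phi>. test_fun \<phi> \<longrightarrow>
        (\<integral>\<zeta>. deriv \<phi> \<zeta> *\<^sub>R u \<zeta> \<partial>unit_itv) = - (\<integral>\<zeta>. \<phi> \<zeta> *\<^sub>R g \<zeta> \<partial>unit_itv))"

primrec sobolev :: "nat \<Rightarrow> (real \<Rightarrow> real^2) set" where
  "sobolev 0 = L2"
| "sobolev (Suc k) = {u \<in> L2. \<exists>g \<in> sobolev k. has_weak_deriv u g}"

text \<open>
  The derivative of a function in \<^term>\<open>sobolev (Suc 0)\<close>; it is unique up to null sets, and
  an arbitrary representative is selected. Hence \<open>(wderiv ^^ j) u\<close> is the \<open>j\<close>-th derivative.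
\<close>

definition wderiv :: "(real \<Rightarrow> real^2) \<Rightarrow> (real \<Rightarrow> real^2)" where
  "wderiv u = (SOME g. g \<in> L2 \<and> has_weak_deriv u g)"

text \<open>The boundary values of an H1 function are those of its continuous representative.\<close>

definition periodic_bdry :: "(real \<Rightarrow> real^2) \<Rightarrow> bool" where
  "periodic_bdry u \<longleftrightarrow>
     (\<exists>w. continuous_on {0..1} w \<and> (AE \<zeta> in unit_itv. w \<zeta> = u \<zeta>) \<and> w 0 = w 1)"

text \<open>The periodic space of order 0 is only a filler value; orders start at 1.\<close>

fun sobolev_per :: "nat \<Rightarrow> (real \<Rightarrow> real^2) set" where
  "sobolev_per 0 = L2"
| "sobolev_per (Suc 0) = {u \<in> sobolev 1. periodic_bdry u}"
| "sobolev_per (Suc (Suc k)) =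
     {u \<in> sobolev (Suc (Suc k)). periodic_bdry u \<and> wderiv u \<in> sobolev_per (Suc k)}"


text \<open>
  Functions of \<open>m + 1\<close> plane vectors are functions of lists, which are only ever applied to lists
  of length \<open>m + 1\<close> such as the following one.
\<close>

definition jet :: "nat \<Rightarrow> (real \<Rightarrow> real^2) \<Rightarrow> real \<Rightarrow> (real^2) list" where
  "jet m u \<zeta> = map (\<lambda>j. (wderiv ^^ j) u \<zeta>) [0..<m+1]"

definition energy :: "nat \<Rightarrow> ((real^2) list \<Rightarrow> real) \<Rightarrow> (real \<Rightarrow> real^2) \<Rightarrow> real" where
  "energy m G u = (\<integral>\<zeta>. G (jet m u \<zeta>) \<partial>unit_itv)"

definition discrete_partial_derivs ::
    "nat \<Rightarrow> ((real^2) list \<Rightarrow> real) \<Rightarrow>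
     (nat \<Rightarrow> (real \<Rightarrow> real^2) \<Rightarrow> (real \<Rightarrow> real^2) \<Rightarrow> real \<Rightarrow> real^2) \<Rightarrow> bool" where
  "discrete_partial_derivs m G D \<longleftrightarrow>
     (\<forall>u \<in> sobolev_per m. \<forall>v \<in> sobolev_per m. AE \<zeta> in unit_itv.
        G (jet m u \<zeta>) - G (jet m v \<zeta>) =
        (\<Sum>j\<le>m. D j u v \<zeta> \<bullet> (wderiv ^^ j) (\<lambda>x. u x - v x) \<zeta>))"


definition knot :: "nat \<Rightarrow> real \<Rightarrow> nat \<Rightarrow> real" where
  "knot p h i = (real i - 1 - real p) * h"

fun bspline :: "(nat \<Rightarrow> real) \<Rightarrow> nat \<Rightarrow> nat \<Rightarrow> real \<Rightarrow> real" where
  "bspline \<xi> 0 i x = indicator {\<xi> i..<\<xi> (i+1)} x"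
| "bspline \<xi> (Suc q) i x =
     (x - \<xi> i) / (\<xi> (i + Suc q) - \<xi> i) * bspline \<xi> q i x +
     (\<xi> (i + Suc q + 1) - x) / (\<xi> (i + Suc q + 1) - \<xi> (i+1)) * bspline \<xi> q (i+1) x"

text \<open>
  For \<open>N > p\<close> the first two intervals below share at most one point, where both
  splines vanish. Functions on [0,1] are extended by 0.
\<close>

definition per_bspline :: "nat \<Rightarrow> nat \<Rightarrow> nat \<Rightarrow> real \<Rightarrow> real" where
  "per_bspline N p i x =
     (let \<xi> = knot p (1 / real N) in
      if x \<notin> {0..1} then 0
      else if i \<le> p then
        (if x \<in> {0..\<xi> (i+p+1)} then bspline \<xi> p i x
         else if x \<in> {\<xi> (i+N)..1} then bspline \<xi> p (i+N) x
         else 0)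
      else bspline \<xi> p i x)"

definition spline_space :: "nat \<Rightarrow> nat \<Rightarrow> (real \<Rightarrow> real^2) set" where
  "spline_space N p = {(\<lambda>x. \<Sum>i=1..N. per_bspline N p i x *\<^sub>R P i) | P. True}"

end

(* The difference v = u1 - u0 of two splines is itself an admissible test function in the scheme.
   With this choice the right-hand side of the scheme becomes, by the defining property of the
   discrete partial derivatives, minus the energy difference, and the left-hand side becomes dt times
   the dissipation integral.  What remains is to see that this is legitimate: a spline of degree
   p > m on uniform knots has continuous derivatives up to order m, which agree almost everywhere
   with the weak derivatives chosen by wderiv because weak derivatives are unique (du Bois-Reymond).
   Hence splines lie in the periodic Sobolev space and the products D_j . v^(j) are integrable. *)
theory Submission
  imports Defs
begin

section \<open>Smooth test functions\<close>

text \<open>\<open>flat 0\<close> is the classical smooth function that is flat at 0. The powers in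
  the denominator are carried along because differentiation produces them.\<close>

definition flat :: "nat \<Rightarrow> real \<Rightarrow> real" where
  "flat k t = (if 0 < t then exp (- (1 / t)) / t ^ k else 0)"

text \<open>The substitution s = 1/t turns this into the decay of s^k / exp s at infinity.\<close>

lemma flat_tendsto_0: "(flat k \<longlongrightarrow> 0) (at_right 0)"
proof -
  have "((\<lambda>t::real. inverse t ^ k / exp (inverse t)) \<longlongrightarrow> 0) (at_right 0)"
    by (rule filterlim_compose[OF tendsto_power_div_exp_0 filterlim_inverse_at_top_right])
  moreover have "eventually (\<lambda>t. inverse t ^ k / exp (inverse t) = flat k t) (at_right 0)"
    unfolding eventually_at_filter
    by (rule always_eventually) (auto simp: flat_def exp_minus field_simps power_divide)
  ultimately show ?thesis
    by (rule Lim_transform_eventually)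
qed

lemma flat_has_derivative:
  "(flat k has_real_derivative flat (k + 2) t - real k * flat (k + 1) t) (at t)"
proof (cases t "0::real" rule: linorder_cases)
  case less
  have "((\<lambda>_. 0) has_real_derivative 0) (at t)" by simp
  then have "(flat k has_real_derivative 0) (at t)"
    by (rule has_field_derivative_transform_within_open[where S = "{..<0}"])
       (use less in \<open>auto simp: flat_def\<close>)
  with less show ?thesis by (simp add: flat_def)
next
  case greater
  have "((\<lambda>t. exp (- (1 / t)) / t ^ k) has_real_derivative
          flat (k + 2) t - real k * flat (k + 1) t) (at t)"
  proof -
    have "((\<lambda>t. exp (- (1 / t))) has_real_derivative exp (- (1 / t)) / t\<^sup>2) (at t)"
      using greater by (auto intro!: derivative_eq_intros simp: power2_eq_square)
    from DERIV_divide[OF this DERIV_pow[of k]] show ?thesis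
    proof (rule DERIV_cong)
      show "(exp (- (1 / t)) / t\<^sup>2 * t ^ k - exp (- (1 / t)) * (real k * t ^ (k - Suc 0)))
          / (t ^ k * t ^ k) = flat (k + 2) t - real k * flat (k + 1) t"
        \<comment> \<open>The exponent \<open>k - Suc 0\<close> is truncated at
          \<open>k = 0\<close>, hence the case split.\<close>
        using greater by (cases k) (simp_all add: flat_def divide_simps power2_eq_square, simp add: algebra_simps)
    qed (use greater in simp)
  qed
  then show ?thesis
    by (rule has_field_derivative_transform_within_open[where S = "{0<..}"])
       (use greater in \<open>auto simp: flat_def\<close>)
next
  case equal
  \<comment> \<open>To the right of 0 the difference quotient of \<open>flat k\<close> is
    \<open>flat (k + 1)\<close>, so differentiability at 0 is the limit lemma at the next
    index.\<close>
  have "((\<lambda>t. (flat k t - flat k 0) / (t - 0)) \<longlongrightarrow> 0) (at 0)"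
  proof (rule filterlim_split_at)
    show "((\<lambda>t. (flat k t - flat k 0) / (t - 0)) \<longlongrightarrow> 0) (at_left 0)"
      by (rule Lim_transform_eventually[OF tendsto_const])
         (auto simp: flat_def eventually_at_filter)
    show "((\<lambda>t. (flat k t - flat k 0) / (t - 0)) \<longlongrightarrow> 0) (at_right 0)"
      by (rule Lim_transform_eventually[OF flat_tendsto_0[of "k + 1"]])
         (auto simp: flat_def eventually_at_filter)
  qed
  then show ?thesis
    using equal by (simp add: has_field_derivative_iff flat_def)
qed

text \<open>This algebra is closed under differentiation, so its elements are smooth.\<close>

inductive_set flat_alg :: "(real \<Rightarrow> real) set" where
  flat: "(\<lambda>x. flat k (c * x + d)) \<in> flat_alg"
| add: "f \<in> flat_alg \<Longrightarrow> g \<in> flat_alg \<Longrightarrow> (\<lambda>x. f x + g x) \<in> flat_alg"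
| mult: "f \<in> flat_alg \<Longrightarrow> g \<in> flat_alg \<Longrightarrow> (\<lambda>x. f x * g x) \<in> flat_alg"
| scale: "f \<in> flat_alg \<Longrightarrow> (\<lambda>x. a * f x) \<in> flat_alg"

lemma flat_alg_deriv:
  "f \<in> flat_alg \<Longrightarrow> \<exists>f'\<in>flat_alg. \<forall>x. (f has_real_derivative f' x) (at x)"
proof (induction rule: flat_alg.induct)
  case (flat k c d)
  have "(\<lambda>x. c * (flat (k + 2) (c * x + d) + (- real k) * flat (k + 1) (c * x + d))) \<in> flat_alg"
    by (intro flat_alg.intros)
  moreover have "((\<lambda>x. flat k (c * x + d)) has_real_derivative
      c * (flat (k + 2) (c * x + d) + (- real k) * flat (k + 1) (c * x + d))) (at x)" for x
  proof -
    have "((\<lambda>x. c * x + d) has_real_derivative c) (at x)"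
      by (auto intro!: derivative_eq_intros)
    from DERIV_chain2[OF flat_has_derivative this] show ?thesis
      by (simp add: algebra_simps)
  qed
  ultimately show ?case by (meson bexI)
next
  case (add f g)
  then obtain f' g' where "f' \<in> flat_alg" "g' \<in> flat_alg"
    "\<forall>x. (f has_real_derivative f' x) (at x)" "\<forall>x. (g has_real_derivative g' x) (at x)"
    by blast
  then show ?case
    by (intro bexI[of _ "\<lambda>x. f' x + g' x"] flat_alg.add allI DERIV_add) auto
next
  case (mult f g)
  then obtain f' g' where "f' \<in> flat_alg" "g' \<in> flat_alg"
    "\<forall>x. (f has_real_derivative f' x) (at x)" "\<forall>x. (g has_real_derivative g' x) (at x)"
    by blast
  then show ?case
    using mult.hyps
    by (intro bexI[of _ "\<lambda>x. f' x * g x + g' x * f x"] flat_alg.add flat_alg.mult allI DERIV_mult) auto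
next
  case (scale f a)
  then obtain f' where "f' \<in> flat_alg" "\<forall>x. (f has_real_derivative f' x) (at x)"
    by blast
  then show ?case
    by (intro bexI[of _ "\<lambda>x. a * f' x"] flat_alg.scale allI DERIV_cmult) auto
qed

lemma flat_alg_deriv_funpow: "f \<in> flat_alg \<Longrightarrow> (deriv ^^ k) f \<in> flat_alg"
proof (induction k)
  case (Suc k)
  then obtain f' where f': "f' \<in> flat_alg" "\<forall>x. ((deriv ^^ k) f has_real_derivative f' x) (at x)"
    using flat_alg_deriv by blast
  then have "deriv ((deriv ^^ k) f) = f'"
    by (auto intro: DERIV_imp_deriv)
  with f' show ?case by simp
qed simp

lemma flat_alg_smooth: "f \<in> flat_alg \<Longrightarrow> (deriv ^^ k) f differentiable (at x)"
  using flat_alg_deriv flat_alg_deriv_funpow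
  by (metis real_differentiable_def)

text \<open>The product is positive exactly on (a,b) for every \<open>n\<close>. The factor
  \<open>Suc n\<close> steepens the flanks: exp(-1/((n+1)t)) tends to 1 for t > 0, so the bumps tend
  to the indicator of (a,b).\<close>

definition bump :: "real \<Rightarrow> real \<Rightarrow> nat \<Rightarrow> real \<Rightarrow> real" where
  "bump a b n x = flat 0 (real (Suc n) * (x - a)) * flat 0 (real (Suc n) * (b - x))"

lemma bump_in_flat_alg: "bump a b n \<in> flat_alg"
proof -
  have "(\<lambda>x. flat 0 (real (Suc n) * x + - (real (Suc n) * a)) *
             flat 0 (- real (Suc n) * x + real (Suc n) * b)) \<in> flat_alg"
    by (intro flat_alg.intros)
  then show ?thesis
    by (simp add: bump_def[abs_def] algebra_simps)
qed

lemma test_fun_bump: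
  assumes "0 < a" "b < 1"
  shows "test_fun (bump a b n)"
proof -
  have "\<forall>x. x \<notin> {a..b} \<longrightarrow> bump a b n x = 0"
    by (auto simp: bump_def flat_def zero_less_mult_iff)
  then show ?thesis
    using assms flat_alg_smooth[OF bump_in_flat_alg] unfolding test_fun_def by blast
qed

lemma abs_bump_le_1: "\<bar>bump a b n x\<bar> \<le> 1"
proof -
  have "\<bar>flat 0 t\<bar> \<le> 1" for t
    by (simp add: flat_def)
  then show ?thesis
    unfolding bump_def abs_mult by (intro mult_le_one) auto
qed

lemma bump_tendsto: "(\<lambda>n. bump a b n x) \<longlonglongrightarrow> indicator {a<..<b} x"
proof -
  have lim: "(\<lambda>n. flat 0 (real (Suc n) * t)) \<longlonglongrightarrow> (if 0 < t then 1 else 0)" for t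
  proof (cases "0 < t")
    case True
    have "(\<lambda>n. exp (- (inverse (real (Suc n)) * inverse t))) \<longlonglongrightarrow> exp (- (0 * inverse t))"
      by (intro tendsto_intros LIMSEQ_inverse_real_of_nat)
    moreover have "flat 0 (real (Suc n) * t) = exp (- (inverse (real (Suc n)) * inverse t))" for n
      using True by (simp add: flat_def zero_less_mult_iff divide_simps del: of_nat_Suc)
    ultimately show ?thesis
      using True by simp
  qed (simp add: flat_def zero_less_mult_iff)
  have "(\<lambda>n. bump a b n x) \<longlonglongrightarrow> (if 0 < x - a then 1 else 0) * (if 0 < b - x then 1 else 0)"
    unfolding bump_def by (intro tendsto_mult lim)
  then show ?thesis
    by (simp add: indicator_def split: if_splits)
qed

section \<open>The fundamental lemma of the calculus of variations\<close>

text \<open>Lebesgue differentiation: at almost every x the averages over [x, x+h] tend to the value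
  at x, and all these averages vanish for small h.\<close>

lemma AE_zero_of_integral_intervals:
  fixes f :: "real \<Rightarrow> 'a :: euclidean_space"
  assumes f: "integrable unit_itv f"
    and zero: "\<And>a b. 0 < a \<Longrightarrow> a < b \<Longrightarrow> b < 1 \<Longrightarrow>
      (\<integral>x. indicator {a<..<b} x *\<^sub>R f x \<partial>unit_itv) = 0"
  shows "AE x in unit_itv. f x = 0"
proof -
  \<comment> \<open>Extension by zero makes the function integrable over every box of the line, as
    the differentiation theorem requires.\<close>
  define g where "g = (\<lambda>x. if x \<in> {0<..<1} then f x else 0)"
  have "integrable lebesgue g"
    unfolding g_def using f by (intro Lebesgue_Measure.integrable_restrict_UNIV[THEN iffD2]) auto
  then have "g integrable_on cbox a b" for a b
    using integrable_on_subcbox[OF integrable_on_lebesgue] by blast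
  then obtain N where N: "negligible N"
    and lim: "\<And>x e. x \<notin> N \<Longrightarrow> 0 < e \<Longrightarrow> \<exists>d>0. \<forall>h. 0 < h \<and> h < d \<longrightarrow>
       norm (integral (cbox x (x + h *\<^sub>R One)) g /\<^sub>R h ^ DIM(real) - g x) < e"
    using integrable_ccontinuous_explicit[of g] by blast
  have int0: "integral (cbox a b) g = 0" if ab: "0 < a" "a < b" "b < 1" for a b
  proof -
    have "integrable unit_itv (\<lambda>x. indicator {a<..<b} x *\<^sub>R f x)"
      using ab by (intro integrable_mult_indicator f) (auto simp: sets_restrict_space_iff)
    then have "((\<lambda>x. if x \<in> {0<..<1} then indicator {a<..<b} x *\<^sub>R f x else 0)
        has_integral 0) UNIV"
      unfolding has_integral_restrict_UNIV
      using has_integral_integral_lebesgue_on zero[OF ab] by fastforce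
    also have "(\<lambda>x. if x \<in> {0<..<1} then indicator {a<..<b} x *\<^sub>R f x else 0) =
        (\<lambda>x. if x \<in> {a<..<b} then g x else 0)"
      using ab by (auto simp: fun_eq_iff g_def indicator_def)
    finally have "(g has_integral 0) {a<..<b}"
      unfolding has_integral_restrict_UNIV .
    then show ?thesis
      by (simp add: has_integral_Icc_iff_Ioo integral_unique)
  qed
  have "f x = 0" if x: "x \<in> {0<..<1}" "x \<notin> N" for x
  proof (rule ccontr)
    assume "f x \<noteq> 0"
    then obtain d where d: "d > 0"
      "\<And>h. 0 < h \<Longrightarrow> h < d \<Longrightarrow> norm (integral (cbox x (x + h)) g /\<^sub>R h - g x) < norm (f x)"
      using lim[OF x(2), of "norm (f x)"] by auto
    \<comment> \<open>The half makes both bounds strict: \<open>h < d\<close> for the estimate and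
      \<open>x + h < 1\<close> to stay inside the interval.\<close>
    define h where "h = min d (1 - x) / 2"
    have h: "0 < h" "h < d" "x + h < 1"
      using d x by (auto simp: h_def min_def field_simps)
    then have "integral (cbox x (x + h)) g = 0"
      using x by (intro int0) auto
    with d(2)[of h] h x show False
      by (simp add: g_def)
  qed
  then have "AE x in lebesgue. x \<in> {0<..<1} \<longrightarrow> f x = 0"
    unfolding eventually_ae_filter_negligible using N by blast
  then show ?thesis
    by (subst AE_restrict_space_iff) auto
qed

lemma bump_measurable [measurable]: "bump a b n \<in> borel_measurable unit_itv"
proof -
  have "isCont (bump a b n) t" for t
    using flat_alg_deriv[OF bump_in_flat_alg] DERIV_isCont by blast
  then have "continuous_on {0<..<1} (bump a b n)"
    by (simp add: continuous_at_imp_continuous_on)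
  then show ?thesis
    by (rule continuous_imp_measurable_on_sets_lebesgue) auto
qed

text \<open>The bumps are test functions that converge boundedly to indicators of intervals, so
  dominated convergence with majorant |f| reduces the claim to vanishing integrals over
  intervals.\<close>

lemma fundamental_lemma:
  fixes f :: "real \<Rightarrow> 'a :: euclidean_space"
  assumes f: "integrable unit_itv f"
    and zero: "\<And>\<phi>. test_fun \<phi> \<Longrightarrow> (\<integral>x. \<phi> x *\<^sub>R f x \<partial>unit_itv) = 0"
  shows "AE x in unit_itv. f x = 0"
proof (rule AE_zero_of_integral_intervals[OF f])
  fix a b :: real assume ab: "0 < a" "a < b" "b < 1"
  have [measurable]: "f \<in> borel_measurable unit_itv"
    using f by simp
  have "(\<lambda>n. \<integral>x. bump a b n x *\<^sub>R f x \<partial>unit_itv) \<longlonglongrightarrow>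
     (\<integral>x. indicator {a<..<b} x *\<^sub>R f x \<partial>unit_itv)"
  proof (rule integral_dominated_convergence[where w = "\<lambda>x. norm (f x)"])
    show "integrable unit_itv (\<lambda>x. norm (f x))"
      using f by simp
    show "AE x in unit_itv. (\<lambda>n. bump a b n x *\<^sub>R f x) \<longlonglongrightarrow> indicator {a<..<b} x *\<^sub>R f x"
      by (intro AE_I2 tendsto_intros bump_tendsto)
    show "AE x in unit_itv. norm (bump a b n x *\<^sub>R f x) \<le> norm (f x)" for n
      using abs_bump_le_1 by (auto simp: mult_left_le_one_le)
    show "(\<lambda>x. indicator {a<..<b} x *\<^sub>R f x) \<in> borel_measurable unit_itv"
      using f by (intro borel_measurable_integrable integrable_mult_indicator)
                 (use ab in \<open>auto simp: sets_restrict_space_iff\<close>)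
  qed measurable
  then show "(\<integral>x. indicator {a<..<b} x *\<^sub>R f x \<partial>unit_itv) = 0"
    using ab by (simp add: zero test_fun_bump LIMSEQ_const_iff)
qed

section \<open>Weak derivatives of piecewise differentiable functions\<close>

lemma finite_measure_unit_itv: "finite_measure unit_itv"
  by (rule finite_measure_lebesgue_on) auto

lemma L2_imp_integrable:
  assumes "f \<in> L2"
  shows "integrable unit_itv f"
proof (rule Bochner_Integration.integrable_bound)
  interpret finite_measure unit_itv
    by (rule finite_measure_unit_itv)
  show "integrable unit_itv (\<lambda>x. 1 + (norm (f x))\<^sup>2)"
    using assms by (auto simp: L2_def)
  \<comment> \<open>This follows from (t - 1/2)^2 >= 0. The constant 1 is integrable because the
    measure is finite.\<close>
  have "t \<le> 1 + t\<^sup>2" for t :: real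
    using zero_le_power2[of "t - 1 / 2"] by (simp add: power2_eq_square algebra_simps)
  then show "AE x in unit_itv. norm (f x) \<le> norm (1 + (norm (f x))\<^sup>2)"
    by (intro AE_I2) (metis abs_ge_self order_trans real_norm_def)
qed (use assms in \<open>auto simp: L2_def\<close>)

lemma continuous_imp_measurable_unit_itv:
  fixes f :: "real \<Rightarrow> 'a :: euclidean_space"
  assumes "continuous_on {0..1} f"
  shows "f \<in> borel_measurable unit_itv"
  by (rule continuous_imp_measurable_on_sets_lebesgue)
     (use assms in \<open>auto intro: continuous_on_subset\<close>)

lemma continuous_bounded_unit_itv:
  fixes f :: "real \<Rightarrow> 'a :: euclidean_space"
  assumes "continuous_on {0..1} f"
  shows "\<exists>B. \<forall>x\<in>{0<..<1}. norm (f x) \<le> B"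
proof -
  have "bounded (f ` {0..1})"
    using assms compact_continuous_image compact_imp_bounded by blast
  then obtain B where "\<forall>y\<in>f ` {0..1}. norm y \<le> B"
    unfolding bounded_iff by blast
  then show ?thesis
    by (intro exI[of _ B]) auto
qed

text \<open>Completeness of Lebesgue measure is the reason. It transfers measurability from a
  continuous representative to an arbitrary one.\<close>

lemma measurable_AE_cong_unit_itv:
  fixes f g :: "real \<Rightarrow> 'a :: euclidean_space"
  assumes f: "f \<in> borel_measurable unit_itv" and eq: "AE x in unit_itv. f x = g x"
  shows "g \<in> borel_measurable unit_itv"
proof -
  have "AE x in lebesgue. (if x \<in> {0<..<1} then f x else 0) = (if x \<in> {0<..<1} then g x else 0)"
    using eq by (subst (asm) AE_restrict_space_iff) auto
  moreover have "(\<lambda>x. if x \<in> {0<..<1} then f x else 0) \<in> borel_measurable lebesgue"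
    using f by (subst borel_measurable_if) auto
  ultimately have "(\<lambda>x. if x \<in> {0<..<1} then g x else 0) \<in> borel_measurable lebesgue"
    by (rule borel_measurable_AE[rotated])
  then show ?thesis
    by (subst (asm) borel_measurable_if) auto
qed

lemma continuous_AE_imp_L2:
  assumes f: "continuous_on {0..1} f" and eq: "AE x in unit_itv. u x = f x"
  shows "u \<in> L2"
proof -
  interpret finite_measure unit_itv
    by (rule finite_measure_unit_itv)
  have [measurable]: "f \<in> borel_measurable unit_itv"
    using f by (rule continuous_imp_measurable_unit_itv)
  have [measurable]: "u \<in> borel_measurable unit_itv"
    by (rule measurable_AE_cong_unit_itv[of f]) (use eq in \<open>auto simp: eq_commute\<close>)
  obtain B where B: "\<And>x. x \<in> {0<..<1} \<Longrightarrow> norm (f x) \<le> B"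
    using continuous_bounded_unit_itv[OF f] by blast
  have "integrable unit_itv (\<lambda>x. (norm (u x))\<^sup>2)"
  proof (rule integrable_const_bound)
    have "AE x in unit_itv. norm (f x) \<le> B"
      by (intro AE_I2) (simp add: B)
    with eq show "AE x in unit_itv. norm ((norm (u x))\<^sup>2) \<le> B\<^sup>2"
      by eventually_elim (simp add: power_mono)
  qed measurable
  then show ?thesis
    by (simp add: L2_def)
qed

text \<open>The exceptional set accommodates the knots, where the last derivative considered may
  have a corner. For continuous \<open>f\<close> the fundamental theorem of calculus tolerates
  it.\<close>

definition deriv_off_finite :: "(real \<Rightarrow> 'a :: real_normed_vector) \<Rightarrow> (real \<Rightarrow> 'a) \<Rightarrow> bool" where
  "deriv_off_finite f g \<longleftrightarrow>
     (\<exists>S. finite S \<and> (\<forall>x\<in>{0<..<1} - S. (f has_vector_derivative g x) (at x)))"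

section \<open>Integration by parts and uniqueness of weak derivatives\<close>

lemma test_fun_deriv:
  assumes "test_fun \<phi>"
  shows "(\<phi> has_real_derivative deriv \<phi> x) (at x)" "isCont \<phi> x" "isCont (deriv \<phi>) x"
    "\<phi> 0 = 0" "\<phi> 1 = 0"
proof -
  have diff: "(deriv ^^ k) \<phi> differentiable (at x)" for k x
    using assms by (auto simp: test_fun_def)
  show "(\<phi> has_real_derivative deriv \<phi> x) (at x)"
    using diff[of 0 x] by (simp add: DERIV_deriv_iff_real_differentiable)
  show "isCont \<phi> x" "isCont (deriv \<phi>) x"
    using diff[of 0 x] diff[of 1 x] by (auto intro: differentiable_imp_continuous_within)
  show "\<phi> 0 = 0" "\<phi> 1 = 0"
    using assms by (auto simp: test_fun_def)
qed

lemma test_fun_measurable: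
  assumes "test_fun \<phi>"
  shows "\<phi> \<in> borel_measurable unit_itv" "deriv \<phi> \<in> borel_measurable unit_itv"
  using test_fun_deriv(2,3)[OF assms]
  by (simp_all add: continuous_imp_measurable_unit_itv continuous_at_imp_continuous_on)

lemma integrable_continuous_scaleR:
  fixes f :: "real \<Rightarrow> 'a :: euclidean_space"
  assumes "continuous_on {0..1} \<psi>" "integrable unit_itv f"
  shows "integrable unit_itv (\<lambda>x. \<psi> x *\<^sub>R f x)"
proof -
  obtain B where B: "\<And>x. x \<in> {0<..<1} \<Longrightarrow> norm (\<psi> x) \<le> B"
    using continuous_bounded_unit_itv[OF assms(1)] by blast
  have [measurable]: "\<psi> \<in> borel_measurable unit_itv" "f \<in> borel_measurable unit_itv"
    using assms continuous_imp_measurable_unit_itv by auto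
  show ?thesis
  proof (rule Bochner_Integration.integrable_bound)
    show "integrable unit_itv (\<lambda>x. B *\<^sub>R f x)"
      using assms by simp
    show "AE x in unit_itv. norm (\<psi> x *\<^sub>R f x) \<le> norm (B *\<^sub>R f x)"
      using B by (intro AE_I2) (force intro!: mult_right_mono)
  qed measurable
qed

text \<open>The product of \<open>f\<close> with a test function is continuous, is differentiable
  off a finite set, and vanishes at 0 and 1. Hence its derivative integrates to zero, which is
  integration by parts without boundary terms.\<close>

lemma has_weak_deriv_of_deriv_off_finite:
  assumes f: "continuous_on {0..1} f" and g: "continuous_on {0..1} g"
    and fg: "deriv_off_finite f g" and eq: "AE x in unit_itv. u x = f x"
  shows "has_weak_deriv u g"
  unfolding has_weak_deriv_def
proof (intro allI impI)
  fix \<phi> assume \<phi>: "test_fun \<phi>"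
  note [measurable] = test_fun_measurable[OF \<phi>]
  note d = test_fun_deriv[OF \<phi>]
  have cont: "continuous_on {0..1} \<phi>" "continuous_on {0..1} (deriv \<phi>)"
    using d(2,3) by (simp_all add: continuous_at_imp_continuous_on)
  obtain S where S: "finite S" "\<And>x. x \<in> {0<..<1} - S \<Longrightarrow> (f has_vector_derivative g x) (at x)"
    using fg unfolding deriv_off_finite_def by blast
  have "((\<lambda>x. \<phi> x *\<^sub>R g x + deriv \<phi> x *\<^sub>R f x) has_integral
      (\<phi> 1 *\<^sub>R f 1 - \<phi> 0 *\<^sub>R f 0)) {0..1}"
    using S(1) cont f S(2) d(1)
    by (intro fundamental_theorem_of_calculus_interior_strong[of S])
       (auto intro!: continuous_intros has_vector_derivative_scaleR)
  then have hi: "((\<lambda>x. \<phi> x *\<^sub>R g x + deriv \<phi> x *\<^sub>R f x) has_integral 0) {0<..<1}"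
    using d by (simp add: has_integral_Icc_iff_Ioo)
  have fi: "integrable unit_itv f" and gi: "integrable unit_itv g"
    using f g by (auto intro!: L2_imp_integrable intro: continuous_AE_imp_L2[OF _ AE_I2])
  note int = integrable_continuous_scaleR[OF cont(1) gi] integrable_continuous_scaleR[OF cont(2) fi]
  have "(\<integral>x. \<phi> x *\<^sub>R g x + deriv \<phi> x *\<^sub>R f x \<partial>unit_itv) = 0"
    using int hi by (subst lebesgue_integral_eq_integral) (auto intro: integral_unique)
  then have "(\<integral>x. deriv \<phi> x *\<^sub>R f x \<partial>unit_itv) = - (\<integral>x. \<phi> x *\<^sub>R g x \<partial>unit_itv)"
    using int by (simp add: eq_neg_iff_add_eq_0 add.commute)
  moreover have "(\<integral>x. deriv \<phi> x *\<^sub>R u x \<partial>unit_itv) = (\<integral>x. deriv \<phi> x *\<^sub>R f x \<partial>unit_itv)"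
  proof (rule integral_cong_AE)
    have [measurable]: "u \<in> borel_measurable unit_itv" "f \<in> borel_measurable unit_itv"
      using continuous_AE_imp_L2[OF f eq] fi by (auto simp: L2_def)
    show "(\<lambda>x. deriv \<phi> x *\<^sub>R u x) \<in> borel_measurable unit_itv"
      "(\<lambda>x. deriv \<phi> x *\<^sub>R f x) \<in> borel_measurable unit_itv"
      by measurable
    show "AE x in unit_itv. deriv \<phi> x *\<^sub>R u x = deriv \<phi> x *\<^sub>R f x"
      using eq by eventually_elim simp
  qed
  ultimately show "(\<integral>x. deriv \<phi> x *\<^sub>R u x \<partial>unit_itv) = - (\<integral>x. \<phi> x *\<^sub>R g x \<partial>unit_itv)"
    by simp
qed

text \<open>The difference \<open>g1 - g2\<close> is annihilated by every test function, so the
  fundamental lemma applies.\<close>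

lemma weak_deriv_unique:
  assumes "g1 \<in> L2" "g2 \<in> L2" "has_weak_deriv u g1" "has_weak_deriv u g2"
  shows "AE x in unit_itv. g1 x = g2 x"
proof -
  have int: "integrable unit_itv g1" "integrable unit_itv g2"
    using assms by (simp_all add: L2_imp_integrable)
  have "AE x in unit_itv. g1 x - g2 x = 0"
  proof (rule fundamental_lemma)
    fix \<phi> assume \<phi>: "test_fun \<phi>"
    then have "continuous_on {0..1} \<phi>"
      using test_fun_deriv(2) by (simp add: continuous_at_imp_continuous_on)
    note i = this[THEN integrable_continuous_scaleR, OF int(1)]
      this[THEN integrable_continuous_scaleR, OF int(2)]
    have "(\<integral>x. \<phi> x *\<^sub>R g1 x \<partial>unit_itv) = (\<integral>x. \<phi> x *\<^sub>R g2 x \<partial>unit_itv)"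
      using assms(3,4)[unfolded has_weak_deriv_def, rule_format, OF \<phi>] by simp
    with i show "(\<integral>x. \<phi> x *\<^sub>R (g1 x - g2 x) \<partial>unit_itv) = 0"
      by (simp add: scaleR_diff_right)
  qed (use int in simp)
  then show ?thesis
    by simp
qed

text \<open>The function \<open>g\<close> witnesses that the choice in \<open>wderiv\<close> has a
  candidate; uniqueness then identifies the chosen representative with \<open>g\<close> almost
  everywhere.\<close>

lemma wderiv_of_deriv_off_finite:
  assumes "continuous_on {0..1} f" and g: "continuous_on {0..1} g"
    and "deriv_off_finite f g" and "AE x in unit_itv. u x = f x"
  shows "AE x in unit_itv. wderiv u x = g x" "wderiv u \<in> L2" "has_weak_deriv u (wderiv u)"
proof -
  have wd: "has_weak_deriv u g"
    using has_weak_deriv_of_deriv_off_finite[OF assms] .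
  have gL2: "g \<in> L2"
    using g by (rule continuous_AE_imp_L2) simp
  have "wderiv u \<in> L2 \<and> has_weak_deriv u (wderiv u)"
    unfolding wderiv_def by (rule someI[of _ g]) (use gL2 wd in simp)
  then show "wderiv u \<in> L2" "has_weak_deriv u (wderiv u)"
    by auto
  then show "AE x in unit_itv. wderiv u x = g x"
    using weak_deriv_unique gL2 wd by blast
qed

text \<open>The conditions at 0 and 1 stop one order short: the derivative of order \<open>k\<close> of
  \<open>f\<close> has to be continuous, but need not be periodic.\<close>

primrec smooth_per :: "nat \<Rightarrow> (real \<Rightarrow> 'a :: real_normed_vector) \<Rightarrow> bool" where
  "smooth_per 0 f \<longleftrightarrow> continuous_on {0..1} f"
| "smooth_per (Suc k) f \<longleftrightarrow>
     continuous_on {0..1} f \<and> f 0 = f 1 \<and> (\<exists>g. deriv_off_finite f g \<and> smooth_per k g)"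

section \<open>Closure properties of \<open>smooth_per\<close>\<close>

lemma smooth_per_continuous: "smooth_per k f \<Longrightarrow> continuous_on {0..1} f"
  by (cases k) auto

lemma deriv_off_finite_add:
  assumes "deriv_off_finite f f'" "deriv_off_finite g g'"
  shows "deriv_off_finite (\<lambda>x. f x + g x) (\<lambda>x. f' x + g' x)"
proof -
  obtain S T where "finite S" "finite T"
    "\<forall>x\<in>{0<..<1} - S. (f has_vector_derivative f' x) (at x)"
    "\<forall>x\<in>{0<..<1} - T. (g has_vector_derivative g' x) (at x)"
    using assms unfolding deriv_off_finite_def by blast
  then show ?thesis
    unfolding deriv_off_finite_def
    by (intro exI[of _ "S \<union> T"]) (auto intro!: has_vector_derivative_add)
qed

lemma deriv_off_finite_linear:
  assumes "bounded_linear L" "deriv_off_finite f f'"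
  shows "deriv_off_finite (\<lambda>x. L (f x)) (\<lambda>x. L (f' x))"
  using assms bounded_linear.has_vector_derivative unfolding deriv_off_finite_def by blast

lemma smooth_per_add:
  "smooth_per k f \<Longrightarrow> smooth_per k g \<Longrightarrow> smooth_per k (\<lambda>x. f x + g x)"
proof (induction k arbitrary: f g)
  case (Suc k)
  then obtain f' g' where "deriv_off_finite f f'" "smooth_per k f'"
    "deriv_off_finite g g'" "smooth_per k g'"
    by auto
  then have "deriv_off_finite (\<lambda>x. f x + g x) (\<lambda>x. f' x + g' x)"
    "smooth_per k (\<lambda>x. f' x + g' x)"
    by (auto intro: deriv_off_finite_add Suc.IH)
  then show ?case
    using Suc.prems by (auto intro!: continuous_intros)
qed (auto intro!: continuous_intros)

lemma smooth_per_linear: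
  assumes L: "bounded_linear L"
  shows "smooth_per k f \<Longrightarrow> smooth_per k (\<lambda>x. L (f x))"
proof (induction k arbitrary: f)
  case 0
  then show ?case
    using L by (auto intro: bounded_linear.continuous_on)
next
  case (Suc k)
  then obtain f' where "deriv_off_finite f f'" "smooth_per k f'"
    by auto
  then have "deriv_off_finite (\<lambda>x. L (f x)) (\<lambda>x. L (f' x))" "smooth_per k (\<lambda>x. L (f' x))"
    using L by (auto intro: deriv_off_finite_linear Suc.IH)
  then show ?case
    using Suc.prems L by (auto intro: bounded_linear.continuous_on)
qed

lemma smooth_per_0: "smooth_per k (\<lambda>_. 0)"
proof (induction k)
  case (Suc k)
  moreover have "deriv_off_finite (\<lambda>_. 0) (\<lambda>_. 0)"
    unfolding deriv_off_finite_def by (rule exI[of _ "{}"]) simp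
  ultimately show ?case by auto
qed simp

lemma smooth_per_sum:
  "(\<And>i. i \<in> I \<Longrightarrow> smooth_per k (f i)) \<Longrightarrow> smooth_per k (\<lambda>x. \<Sum>i\<in>I. f i x)"
  by (induction I rule: infinite_finite_induct) (auto intro: smooth_per_add smooth_per_0)

section \<open>From piecewise smoothness to the periodic Sobolev spaces\<close>

lemma sobolev_per_subset_sobolev: "sobolev_per k \<subseteq> sobolev k"
  by (cases k rule: sobolev_per.cases) auto

text \<open>The induction passes from the pair \<open>u\<close>, \<open>f\<close> to the pair
  \<open>wderiv u\<close>, \<open>g\<close>. At each level \<open>f\<close> serves as the continuous
  representative that \<open>periodic_bdry\<close> asks for.\<close>

lemma smooth_per_imp_sobolev_per:
  assumes "smooth_per k f" "AE x in unit_itv. u x = f x"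
  shows "u \<in> sobolev_per k"
  using assms
proof (induction k arbitrary: u f)
  case 0
  then show ?case
    by (auto intro: continuous_AE_imp_L2)
next
  case (Suc k)
  then obtain g where f: "continuous_on {0..1} f" "f 0 = f 1"
    and g: "deriv_off_finite f g" "smooth_per k g"
    by auto
  note w = wderiv_of_deriv_off_finite[OF f(1) smooth_per_continuous[OF g(2)] g(1) Suc.prems(2)]
  have "u \<in> L2"
    using continuous_AE_imp_L2[OF f(1) Suc.prems(2)] .
  moreover have IH: "wderiv u \<in> sobolev_per k"
    using Suc.IH[OF g(2) w(1)] .
  ultimately have sob: "u \<in> sobolev (Suc k)"
    using w sobolev_per_subset_sobolev by auto
  have "periodic_bdry u"
    unfolding periodic_bdry_def using f Suc.prems(2) by (intro exI[of _ f]) (auto simp: eq_commute)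
  \<comment> \<open>Order 1 has its own clause in \<open>sobolev_per\<close>, without a periodicity
    condition on the derivative.\<close>
  with sob IH show ?case
    by (cases k) auto
qed

text \<open>The continuous representative provides the bound on the derivatives of the test function
  in the energy identity.\<close>

lemma smooth_per_imp_wderiv_continuous:
  assumes "smooth_per k f" "AE x in unit_itv. u x = f x" "j \<le> k"
  shows "\<exists>g. continuous_on {0..1} g \<and> (AE x in unit_itv. (wderiv ^^ j) u x = g x)"
  using assms
proof (induction j arbitrary: k u f)
  case 0
  then show ?case
    using smooth_per_continuous by auto
next
  case (Suc j)
  then obtain k' where k': "k = Suc k'" "j \<le> k'"
    by (cases k) auto
  with Suc.prems obtain g where f: "continuous_on {0..1} f"
    and g: "deriv_off_finite f g" "smooth_per k' g"
    by auto
  note w = wderiv_of_deriv_off_finite[OF f smooth_per_continuous[OF g(2)] g(1) Suc.prems(2)]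
  show ?case
    using Suc.IH[OF g(2) w(1) k'(2)] by (simp add: funpow_swap1)
qed

section \<open>Splines on uniform knots\<close>

lemma knot_add: "knot p h (i + k) = knot p h i + real k * h"
  by (simp add: knot_def algebra_simps)

text \<open>On uniform knots both denominators of the recursion equal
  \<open>(q + 1) * h\<close>.\<close>

lemma bspline_knot_Suc:
  assumes "h > 0"
  shows "bspline (knot p h) (Suc q) i x =
    ((x - knot p h i) * bspline (knot p h) q i x +
     (knot p h i + (real q + 2) * h - x) * bspline (knot p h) q (i + 1) x) / ((real q + 1) * h)"
proof -
  have eq: "knot p h (i + Suc q) = knot p h i + (real q + 1) * h"
    "knot p h (i + Suc q + 1) = knot p h i + (real q + 2) * h"
    "knot p h (i + 1) = knot p h i + h"
    by (simp_all add: knot_def algebra_simps)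
  have "bspline (knot p h) (Suc q) i x =
    (x - knot p h i) / ((real q + 1) * h) * bspline (knot p h) q i x +
    (knot p h i + (real q + 2) * h - x) / ((real q + 1) * h) * bspline (knot p h) q (i + 1) x"
    unfolding bspline.simps eq by (simp add: algebra_simps)
  then show ?thesis
    by (simp add: add_divide_distrib)
qed

text \<open>The two ends are treated differently because degree 0 is the indicator of a half-open
  interval, equal to 1 at its left knot. From degree 1 on, the factor \<open>x - knot p h i\<close>
  removes that value.\<close>

lemma bspline_eq_0:
  assumes "h > 0"
    and "x < knot p h i \<or> (x = knot p h i \<and> q > 0) \<or> knot p h (i + q + 1) \<le> x"
  shows "bspline (knot p h) q i x = 0"
  using assms(2)
proof (induction q arbitrary: i)
  case 0
  then show ?case by (auto simp: indicator_def)
next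
  case (Suc q)
  have k: "knot p h (i + q + 1) = knot p h i + (real q + 1) * h"
    "knot p h (i + Suc q + 1) = knot p h i + (real q + 2) * h"
    "knot p h (i + 1 + q + 1) = knot p h i + (real q + 2) * h"
    "knot p h (i + 1) = knot p h i + h"
    by (simp_all add: knot_def algebra_simps)
  have le: "(real q + 1) * h \<le> (real q + 2) * h"
    using \<open>h > 0\<close> by (simp add: algebra_simps)
  have "(x - knot p h i) * bspline (knot p h) q i x = 0"
    using Suc.IH[of i] Suc.prems le unfolding k by auto
  moreover have "bspline (knot p h) q (i + 1) x = 0"
    using Suc.IH[of "i + 1"] Suc.prems \<open>h > 0\<close> unfolding k by auto
  ultimately show ?case
    by (simp add: bspline_knot_Suc[OF \<open>h > 0\<close>])
qed

lemma continuous_bspline: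
  assumes "h > 0" "q > 0"
  shows "continuous_on UNIV (bspline (knot p h) q i)"
proof -
  from \<open>q > 0\<close> obtain r where "q = Suc r"
    by (cases q) auto
  moreover have "continuous_on UNIV (bspline (knot p h) (Suc r) i)" for r
  proof (induction r arbitrary: i)
    case 0
    \<comment> \<open>The induction starts at degree 1, since degree 0 is discontinuous. Degree 1 is
      the hat function, the positive part of the minimum of two affine functions.\<close>
    have "bspline (knot p h) (Suc 0) i =
      (\<lambda>x. max 0 (min ((x - knot p h i) / h) ((knot p h i + 2 * h - x) / h)))"
    proof
      fix x
      have k: "knot p h (i + 1) = knot p h i + h" "knot p h (i + 1 + 1) = knot p h i + 2 * h"
        by (simp_all add: knot_def algebra_simps)
      show "bspline (knot p h) (Suc 0) i x =
        max 0 (min ((x - knot p h i) / h) ((knot p h i + 2 * h - x) / h))"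
        unfolding bspline_knot_Suc[OF \<open>h > 0\<close>] bspline.simps(1) k
        using \<open>h > 0\<close> by (auto simp: indicator_def max_def min_def divide_simps)
    qed
    then show ?case
      using \<open>h > 0\<close> by (auto intro!: continuous_intros)
  next
    case (Suc r)
    show ?case
      unfolding bspline_knot_Suc[OF \<open>h > 0\<close>, of p "Suc r" i, abs_def]
      using \<open>h > 0\<close> by (intro continuous_intros Suc.IH) auto
  qed
  ultimately show ?thesis
    by simp
qed

lemma bspline_0_has_derivative:
  assumes "x \<noteq> \<xi> i" "x \<noteq> \<xi> (i + 1)"
  shows "(bspline \<xi> 0 i has_real_derivative 0) (at x)"
proof -
  have "x \<in> - {\<xi> i, \<xi> (i + 1)}" "open (- {\<xi> i, \<xi> (i + 1)})"
    using assms by auto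
  then obtain e where e: "e > 0" "ball x e \<subseteq> - {\<xi> i, \<xi> (i + 1)}"
    by (meson openE)
  have "\<xi> i \<notin> ball x e" "\<xi> (i + 1) \<notin> ball x e"
    using e by auto
  then have "bspline \<xi> 0 i x = bspline \<xi> 0 i y" if "y \<in> ball x e" for y
    using that by (auto simp: indicator_def dist_real_def split: if_splits)
  with e(1) show ?thesis
    by (intro has_field_derivative_transform_within_open[OF DERIV_const, of "ball x e"]) auto
qed

text \<open>Differentiating the recursion gives the difference of the two splines of lower degree
  once from the linear factors and \<open>q\<close> times more from their derivatives. The total
  factor \<open>q + 1\<close> cancels against the denominator \<open>(q + 1) * h\<close>.\<close>

lemma bspline_has_derivative:
  assumes "h > 0" and "\<And>j. j \<le> i + q + 1 \<Longrightarrow> x \<noteq> knot p h j"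
  shows "(bspline (knot p h) q i has_real_derivative
    (if q = 0 then 0 else (bspline (knot p h) (q - 1) i x - bspline (knot p h) (q - 1) (i + 1) x) / h))
    (at x)"
  using assms(2)
proof (induction q arbitrary: i)
  case 0
  then have "(bspline (knot p h) 0 i has_real_derivative 0) (at x)"
    by (intro bspline_0_has_derivative) auto
  then show ?case by (simp del: bspline.simps)
next
  case (Suc q)
  define d where "d i = (if q = 0 then 0 else
    (bspline (knot p h) (q - 1) i x - bspline (knot p h) (q - 1) (i + 1) x) / h)" for i
  let ?b = "bspline (knot p h) q" and ?k = "knot p h i"
  have d: "(?b i has_real_derivative d i) (at x)" "(?b (i + 1) has_real_derivative d (i + 1)) (at x)"
    unfolding d_def by (intro Suc.IH Suc.prems; simp)+
  have "((\<lambda>x. ((x - ?k) * ?b i x + (?k + (real q + 2) * h - x) * ?b (i + 1) x) / ((real q + 1) * h))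
     has_real_derivative
     ((?b i x + (x - ?k) * d i) + ((?k + (real q + 2) * h - x) * d (i + 1) - ?b (i + 1) x)) /
       ((real q + 1) * h)) (at x)"
  proof (rule DERIV_cdivide)
    have "((\<lambda>x. x - ?k) has_real_derivative 1) (at x)"
      "((\<lambda>x. ?k + (real q + 2) * h - x) has_real_derivative - 1) (at x)"
      by (auto intro!: derivative_eq_intros)
    from DERIV_add[OF DERIV_mult[OF this(1) d(1)] DERIV_mult[OF this(2) d(2)]]
    show "((\<lambda>x. (x - ?k) * ?b i x + (?k + (real q + 2) * h - x) * ?b (i + 1) x)
       has_real_derivative
       (?b i x + (x - ?k) * d i) + ((?k + (real q + 2) * h - x) * d (i + 1) - ?b (i + 1) x)) (at x)"
      by (rule DERIV_cong) (simp add: algebra_simps)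
  qed
  \<comment> \<open>For positive \<open>q\<close>, expanding both splines on the right by the
    recursion gives the same combination of the three neighbouring splines of degree
    \<open>q - 1\<close> as on the left.\<close>
  moreover have "(x - ?k) * d i + (?k + (real q + 2) * h - x) * d (i + 1) =
      real q * (?b i x - ?b (i + 1) x)"
  proof (cases q)
    case 0
    then show ?thesis by (simp add: d_def)
  next
    case (Suc r)
    have k: "knot p h (i + 1) = ?k + h"
      by (simp add: knot_def algebra_simps)
    show ?thesis
      unfolding d_def Suc bspline_knot_Suc[OF \<open>h > 0\<close>] k
      using \<open>h > 0\<close> by (simp add: divide_simps) (simp add: algebra_simps)
  qed
  then have "((?b i x + (x - ?k) * d i) + ((?k + (real q + 2) * h - x) * d (i + 1) - ?b (i + 1) x)) /
       ((real q + 1) * h) = (real q + 1) * (?b i x - ?b (i + 1) x) / ((real q + 1) * h)"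
    by (simp add: algebra_simps)
  ultimately have "((\<lambda>x. ((x - ?k) * ?b i x + (?k + (real q + 2) * h - x) * ?b (i + 1) x) /
      ((real q + 1) * h)) has_real_derivative (?b i x - ?b (i + 1) x) / h) (at x)"
    by simp
  then show ?case
    unfolding bspline_knot_Suc[OF \<open>h > 0\<close>, abs_def] by simp
qed

section \<open>Periodic splines as sums of two translates one period apart\<close>

lemma bspline_shift:
  assumes "N > 0"
  shows "bspline (knot p (1 / real N)) q (i + N) x = bspline (knot p (1 / real N)) q i (x - 1)"
proof (induction q arbitrary: i)
  have k: "knot p (1 / real N) (j + N) = knot p (1 / real N) j + 1" for j
    using assms by (simp add: knot_add)
  {
    case 0
    then show ?case
      using k[of i] k[of "i + 1"] by (auto simp: indicator_def)
  next
    case (Suc q)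
    then show ?case
      using assms Suc.IH[of "i + 1"]
      by (simp add: bspline_knot_Suc k del: bspline.simps) (simp add: algebra_simps)
  }
qed

text \<open>The derivative is a difference of two sums of the same form, of degree
  \<open>q - 1\<close> and with indices \<open>i\<close> and \<open>i + 1\<close>, so induction on
  \<open>k\<close> applies. The bound \<open>i + q \<le> N + p\<close> survives this passage, and it
  says that the support of the spline with index \<open>i\<close> ends at or before 1.\<close>

lemma smooth_per_bspline:
  assumes "N > p" and "k < q" and "i + q \<le> N + p"
  shows "smooth_per k (\<lambda>x. bspline (knot p (1 / real N)) q i x +
                           bspline (knot p (1 / real N)) q (i + N) x)"
  using assms(2,3)
proof (induction k arbitrary: q i)
  let ?b = "bspline (knot p (1 / real N))"
  have h: "1 / real N > 0"
    using \<open>N > p\<close> by simp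
  have cont: "continuous_on A (\<lambda>x. ?b q i x + ?b q (i + N) x)" if "q > 0" for q i A
    using continuous_bspline[OF h that] by (intro continuous_intros) (auto intro: continuous_on_subset)
  {
    case 0
    then show ?case by (simp add: cont)
  next
    case (Suc k)
    then obtain r where q: "q = Suc r" "k < r"
      by (cases q) auto
    \<comment> \<open>Periodicity: the translate has not yet started at 0, the original has ended at
      1, and the two remaining values agree by the shift.\<close>
    have "knot p (1 / real N) (i + N) \<ge> 0"
      using \<open>N > p\<close> by (simp add: knot_def)
    then have "?b q (i + N) 0 = 0"
      using h q by (intro bspline_eq_0) auto
    moreover have "knot p (1 / real N) (i + q + 1) \<le> 1"
      using Suc.prems(2) \<open>N > p\<close> by (simp add: knot_def divide_simps)
    then have "?b q i 1 = 0"
      using h by (intro bspline_eq_0) auto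
    moreover have "?b q (i + N) 1 = ?b q i 0"
      using \<open>N > p\<close> by (simp add: bspline_shift)
    ultimately have per: "?b q i 0 + ?b q (i + N) 0 = ?b q i 1 + ?b q (i + N) 1"
      by simp
    \<comment> \<open>The factor \<open>real N\<close> is 1/h. The four terms are grouped by index
      rather than by translate, so that each bracket is an instance of the induction
      hypothesis.\<close>
    define g where "g x = real N * (?b r i x + ?b r (i + N) x) +
        (- real N) * (?b r (i + 1) x + ?b r (i + 1 + N) x)" for x
    have "smooth_per k (\<lambda>x. ?b r i x + ?b r (i + N) x)"
      "smooth_per k (\<lambda>x. ?b r (i + 1) x + ?b r (i + 1 + N) x)"
      using q Suc.prems by (simp_all add: Suc.IH del: add_Suc)
    then have "smooth_per k g"
      unfolding g_def
      by (rule smooth_per_add[OF smooth_per_linear smooth_per_linear,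
            OF bounded_linear_mult_right _ bounded_linear_mult_right])
    moreover have "deriv_off_finite (\<lambda>x. ?b q i x + ?b q (i + N) x) g"
      unfolding deriv_off_finite_def
    proof (intro exI[of _ "knot p (1 / real N) ` {..i + N + q + 1}"] conjI ballI)
      fix x assume x: "x \<in> {0<..<1} - knot p (1 / real N) ` {..i + N + q + 1}"
      have d: "(?b q j has_real_derivative (?b r j x - ?b r (j + 1) x) / (1 / real N)) (at x)"
        if "j \<le> i + N" for j
      proof -
        have "x \<noteq> knot p (1 / real N) l" if "l \<le> j + q + 1" for l
          using x that \<open>j \<le> i + N\<close> by auto
        from bspline_has_derivative[OF h, of j q x p, OF this] show ?thesis
          using q(1) by (simp del: bspline.simps)
      qed
      show "((\<lambda>x. ?b q i x + ?b q (i + N) x) has_vector_derivative g x) (at x)"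
        unfolding has_real_derivative_iff_has_vector_derivative[symmetric] g_def
        by (rule DERIV_cong[OF DERIV_add[OF d d]]) (simp_all add: algebra_simps)
    qed simp
    moreover have "continuous_on {0..1} (\<lambda>x. ?b q i x + ?b q (i + N) x)"
      using q(1) by (intro cont) simp
    ultimately show ?case
      unfolding smooth_per.simps using per by blast
  }
qed

text \<open>For \<open>i \<le> p\<close> the supports of the two splines overlap in at most a point
  because \<open>N > p\<close>, and wherever one is selected the other vanishes. For
  \<open>i > p\<close> the translate starts at or beyond 1.\<close>

lemma per_bspline_eq:
  assumes "p > 0" "N > p" "i \<le> N" "x \<in> {0<..<1}"
  shows "per_bspline N p i x =
    bspline (knot p (1 / real N)) p i x + bspline (knot p (1 / real N)) p (i + N) x"
proof -
  let ?k = "knot p (1 / real N)"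
  have h: "1 / real N > 0"
    using \<open>N > p\<close> by simp
  have left: "bspline ?k p (i + N) x = 0" if "x \<le> ?k (i + N)"
    using that h \<open>p > 0\<close> by (intro bspline_eq_0) auto
  have right: "bspline ?k p i x = 0" if "?k (i + p + 1) \<le> x"
    using that h by (intro bspline_eq_0) auto
  have le: "?k (i + p + 1) \<le> ?k (i + N)"
    using assms by (simp add: knot_def divide_simps)
  have "1 \<le> ?k (i + N)" if "i > p"
    using assms that by (simp add: knot_def divide_simps)
  then show ?thesis
    using assms left right le unfolding per_bspline_def Let_def by auto
qed

lemma spline_space_smooth_per:
  assumes "u \<in> spline_space N p" "p > k" "N > p"
  obtains f where "smooth_per k f" "AE x in unit_itv. u x = f x"
proof -
  let ?b = "bspline (knot p (1 / real N)) p"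
  obtain P where u: "u = (\<lambda>x. \<Sum>i=1..N. per_bspline N p i x *\<^sub>R P i)"
    using assms(1) unfolding spline_space_def by blast
  show ?thesis
  proof (rule that)
    \<comment> \<open>With \<open>q = p\<close> the index condition of
      \<open>smooth_per_bspline\<close> is just \<open>i \<le> N\<close>.\<close>
    show "smooth_per k (\<lambda>x. \<Sum>i=1..N. (?b i x + ?b (i + N) x) *\<^sub>R P i)"
      using assms
      by (intro smooth_per_sum smooth_per_linear[OF bounded_linear_scaleR_left] smooth_per_bspline) auto
    show "AE x in unit_itv. u x = (\<Sum>i=1..N. (?b i x + ?b (i + N) x) *\<^sub>R P i)"
      unfolding u using assms by (intro AE_I2 sum.cong) (auto simp: per_bspline_eq)
  qed
qed

lemma spline_space_diff:
  assumes "u \<in> spline_space N p" "v \<in> spline_space N p"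
  shows "(\<lambda>x. u x - v x) \<in> spline_space N p"
proof -
  obtain P Q where "u = (\<lambda>x. \<Sum>i=1..N. per_bspline N p i x *\<^sub>R P i)"
    "v = (\<lambda>x. \<Sum>i=1..N. per_bspline N p i x *\<^sub>R Q i)"
    using assms unfolding spline_space_def by blast
  then have "(\<lambda>x. u x - v x) = (\<lambda>x. \<Sum>i=1..N. per_bspline N p i x *\<^sub>R (P i - Q i))"
    by (simp add: scaleR_diff_right sum_subtractf)
  then show ?thesis
    unfolding spline_space_def by (intro CollectI exI conjI TrueI)
qed

text \<open>The discrete partial derivatives are only assumed integrable, so the other factor has to
  be essentially bounded; square integrability would not suffice.\<close>

lemma integrable_inner_AE_continuous:
  fixes D :: "real \<Rightarrow> 'a :: euclidean_space"
  assumes D: "integrable unit_itv D" and g: "continuous_on {0..1} g"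
    and eq: "AE x in unit_itv. w x = g x"
  shows "integrable unit_itv (\<lambda>x. D x \<bullet> w x)"
proof -
  obtain B where B: "\<forall>x\<in>{0<..<1}. norm (g x) \<le> B"
    using continuous_bounded_unit_itv[OF g] by blast
  have [measurable]: "D \<in> borel_measurable unit_itv" "g \<in> borel_measurable unit_itv"
    using D g continuous_imp_measurable_unit_itv by auto
  have [measurable]: "w \<in> borel_measurable unit_itv"
    by (rule measurable_AE_cong_unit_itv[of g]) (use eq in \<open>auto simp: eq_commute\<close>)
  show ?thesis
  proof (rule Bochner_Integration.integrable_bound)
    show "integrable unit_itv (\<lambda>x. B *\<^sub>R D x)"
      using D by simp
    have "AE x in unit_itv. norm (g x) \<le> B"
      using B by (intro AE_I2) simp
    with eq show "AE x in unit_itv. norm (D x \<bullet> w x) \<le> norm (B *\<^sub>R D x)"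
    proof eventually_elim
      case (elim x)
      have "\<bar>D x \<bullet> w x\<bar> \<le> norm (D x) * norm (w x)"
        by (rule Cauchy_Schwarz_ineq2)
      also have "\<dots> \<le> norm (D x) * \<bar>B\<bar>"
        using elim by (intro mult_left_mono) auto
      finally show ?case
        by (simp add: mult.commute)
    qed
  qed measurable
qed

section \<open>The energy identity\<close>

theorem lemma3p3:
  fixes m p N :: nat
    and F G :: "(real^2) list \<Rightarrow> real"
    and D :: "nat \<Rightarrow> (real \<Rightarrow> real^2) \<Rightarrow> (real \<Rightarrow> real^2) \<Rightarrow> real \<Rightarrow> real^2"
    and dt :: real
    and u0 u1 :: "real \<Rightarrow> real^2"
  assumes "m \<ge> 1" and "p \<ge> m + 1" and "N > p"
    and G: "G = (\<lambda>ps. F ps * norm (ps ! 1))"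
    and D: "discrete_partial_derivs m G D"
    and "dt > 0"
    and "u0 \<in> spline_space N p" and "u1 \<in> spline_space N p"
    and "integrable unit_itv (\<lambda>\<zeta>. G (jet m u0 \<zeta>))"
    and "integrable unit_itv (\<lambda>\<zeta>. G (jet m u1 \<zeta>))"
    and "\<And>j. j \<le> m \<Longrightarrow> integrable unit_itv (D j u1 u0)"
    and scheme: "\<And>v. v \<in> spline_space N p \<Longrightarrow>
      inner_L2 (\<lambda>\<zeta>. norm ((wderiv u1 \<zeta> + wderiv u0 \<zeta>) /\<^sub>R 2) *\<^sub>R ((u1 \<zeta> - u0 \<zeta>) /\<^sub>R dt)) v
      = - (\<Sum>j\<le>m. inner_L2 (D j u1 u0) ((wderiv ^^ j) v))"
  shows "(energy m G u1 - energy m G u0) / dt =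
      - (\<integral>\<zeta>. norm ((wderiv u1 \<zeta> + wderiv u0 \<zeta>) /\<^sub>R 2) *
             (norm ((u1 \<zeta> - u0 \<zeta>) /\<^sub>R dt))\<^sup>2 \<partial>unit_itv)
    \<and> - (\<integral>\<zeta>. norm ((wderiv u1 \<zeta> + wderiv u0 \<zeta>) /\<^sub>R 2) *
             (norm ((u1 \<zeta> - u0 \<zeta>) /\<^sub>R dt))\<^sup>2 \<partial>unit_itv) \<le> 0"
proof -
  define v where "v = (\<lambda>x. u1 x - u0 x)"
  define a where "a \<zeta> = norm ((wderiv u1 \<zeta> + wderiv u0 \<zeta>) /\<^sub>R 2)" for \<zeta>
  have pm: "p > m"
    using \<open>p \<ge> m + 1\<close> by simp
  have v: "v \<in> spline_space N p"
    unfolding v_def using assms(7,8) by (intro spline_space_diff)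
  have per: "u \<in> sobolev_per m" if u: "u \<in> spline_space N p" for u
    by (rule spline_space_smooth_per[OF u pm \<open>N > p\<close>]) (rule smooth_per_imp_sobolev_per)
  have int: "integrable unit_itv (\<lambda>\<zeta>. D j u1 u0 \<zeta> \<bullet> (wderiv ^^ j) v \<zeta>)" if j: "j \<le> m" for j
  proof -
    obtain f where "smooth_per m f" "AE x in unit_itv. v x = f x"
      using spline_space_smooth_per[OF v pm \<open>N > p\<close>] .
    then obtain g where "continuous_on {0..1} g" "AE x in unit_itv. (wderiv ^^ j) v x = g x"
      using smooth_per_imp_wderiv_continuous j by blast
    with assms(11)[OF j] show ?thesis
      by (rule integrable_inner_AE_continuous)
  qed
  \<comment> \<open>The test function is the undivided difference \<open>w\<close>, so pairing it
    with the difference quotient leaves one factor \<open>dt\<close>, which later cancels against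
    the denominator of the energy quotient.\<close>
  have inner_eq: "(c *\<^sub>R (w /\<^sub>R dt)) \<bullet> w = dt * (c * (norm (w /\<^sub>R dt))\<^sup>2)"
    for c and w :: "real^2"
    unfolding power2_norm_eq_inner using \<open>dt > 0\<close> by (simp add: field_simps)
  have "energy m G u1 - energy m G u0 = (\<integral>\<zeta>. G (jet m u1 \<zeta>) - G (jet m u0 \<zeta>) \<partial>unit_itv)"
    unfolding energy_def using assms(9,10) by simp
  also have "\<dots> = (\<integral>\<zeta>. (\<Sum>j\<le>m. D j u1 u0 \<zeta> \<bullet> (wderiv ^^ j) v \<zeta>) \<partial>unit_itv)"
  proof (rule integral_cong_AE)
    show "(\<lambda>\<zeta>. G (jet m u1 \<zeta>) - G (jet m u0 \<zeta>)) \<in> borel_measurable unit_itv"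
      using assms(9,10) by (intro borel_measurable_diff) auto
    show "(\<lambda>\<zeta>. \<Sum>j\<le>m. D j u1 u0 \<zeta> \<bullet> (wderiv ^^ j) v \<zeta>) \<in> borel_measurable unit_itv"
      using int by (intro borel_measurable_sum) auto
    show "AE \<zeta> in unit_itv. G (jet m u1 \<zeta>) - G (jet m u0 \<zeta>) =
        (\<Sum>j\<le>m. D j u1 u0 \<zeta> \<bullet> (wderiv ^^ j) v \<zeta>)"
      using D per[OF assms(7)] per[OF assms(8)] unfolding discrete_partial_derivs_def v_def by blast
  qed
  also have "\<dots> = (\<Sum>j\<le>m. inner_L2 (D j u1 u0) ((wderiv ^^ j) v))"
    \<comment> \<open>Exchanging sum and integral requires each summand to be integrable, which is
      the purpose of \<open>int\<close>.\<close>
    unfolding inner_L2_def using int by (intro Bochner_Integration.integral_sum) auto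
  also have "\<dots> = - inner_L2 (\<lambda>\<zeta>. a \<zeta> *\<^sub>R ((u1 \<zeta> - u0 \<zeta>) /\<^sub>R dt)) v"
    using scheme[OF v] by (simp add: a_def)
  also have "inner_L2 (\<lambda>\<zeta>. a \<zeta> *\<^sub>R ((u1 \<zeta> - u0 \<zeta>) /\<^sub>R dt)) v =
      (\<integral>\<zeta>. dt * (a \<zeta> * (norm ((u1 \<zeta> - u0 \<zeta>) /\<^sub>R dt))\<^sup>2) \<partial>unit_itv)"
    unfolding inner_L2_def v_def by (intro Bochner_Integration.integral_cong refl inner_eq)
  \<comment> \<open>A constant factor comes out irrespective of integrability, because the integral
    of a non-integrable function is 0 by convention.\<close>
  also have "\<dots> = dt * (\<integral>\<zeta>. a \<zeta> * (norm ((u1 \<zeta> - u0 \<zeta>) /\<^sub>R dt))\<^sup>2 \<partial>unit_itv)"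
    by (rule integral_mult_right_zero)
  finally have "(energy m G u1 - energy m G u0) / dt =
      - (\<integral>\<zeta>. a \<zeta> * (norm ((u1 \<zeta> - u0 \<zeta>) /\<^sub>R dt))\<^sup>2 \<partial>unit_itv)"
    using \<open>dt > 0\<close> by (simp add: field_simps)
  moreover have "0 \<le> (\<integral>\<zeta>. a \<zeta> * (norm ((u1 \<zeta> - u0 \<zeta>) /\<^sub>R dt))\<^sup>2 \<partial>unit_itv)"
    by (intro integral_nonneg_AE AE_I2) (simp add: a_def)
  ultimately show ?thesis
    unfolding a_def by simp
qed

end
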